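(* For any three distinct primes $p,q,r$, the group $\mathbb{Z}_{pqr}\times\mathbb{Z}_p$ is a minimal imperfect group; that is, $D(\mathbb{Z}_{pqr}\times\mathbb{Z}_p)$ is not perfect, while $D(H)$ is perfect for every proper subgroup $H$ of $\mathbb{Z}_{pqr}\times\mathbb{Z}_p$.
   Context: For a group $G$, the power graph $\mathsf{Pow}(G)$ has vertex set $G$, with distinct $a,b$ adjacent iff $a\in\langle b\rangle$ or $b\in\langle a\rangle$. The enhanced power graph $\mathsf{EPow}(G)$ has vertex set $G$, with distinct $a,b$ adjacent iff $\langle a,b\rangle$ is cyclic. The difference graph $D(G)$ is the graph $\mathsf{EPow}(G)-\mathsf{Pow}(G)$ with all isolated vertices removed; thus $x\sim y$ in $D(G)$ iff $\langle x,y\rangle$ is cyclic, $x\notin\langle y\rangle$ and $y\notin\langle x\rangle$. A group $G$ is called a minimal imperfect group if $D(G)$ is not perfect and $D(H)$ is perfect for every proper subgroup $H$ of $G$. *)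

theory Defs
  imports
    "HOL-Algebra.Elementary_Groups"
    "HOL-Computational_Algebra.Primes"
    "HOL-Library.Extended_Nat"
    "Graph_Theory.Graph_Theory"
begin

text \<open>
  As in \<^theory>\<open>Graph_Theory.Digraph\<close>, an undirected simple graph is a loop-free symmetric
  digraph, here mostly a \<^typ>\<open>'a pair_pre_digraph\<close>, whose arcs are pairs of vertices.
\<close>

section \<open>Perfect graphs\<close>

definition colourable :: "('a, 'b) pre_digraph \<Rightarrow> nat \<Rightarrow> bool" where
  "colourable \<Gamma> k \<longleftrightarrow>
     (\<exists>c. c ` verts \<Gamma> \<subseteq> {..<k} \<and> (\<forall>u v. u \<rightarrow>\<^bsub>\<Gamma>\<^esub> v \<longrightarrow> c u \<noteq> c v))"

definition is_clique :: "('a, 'b) pre_digraph \<Rightarrow> 'a set \<Rightarrow> bool" where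
  "is_clique \<Gamma> K \<longleftrightarrow> K \<subseteq> verts \<Gamma> \<and> (\<forall>u\<in>K. \<forall>v\<in>K. u \<noteq> v \<longrightarrow> u \<rightarrow>\<^bsub>\<Gamma>\<^esub> v)"

text \<open>
  Both invariants take values in \<^typ>\<open>enat\<close>, so that they are also meaningful for graphs without
  a finite colouring or with unboundedly large finite cliques, where the value is \<open>\<infinity>\<close>.
\<close>

definition chromatic_number :: "('a, 'b) pre_digraph \<Rightarrow> enat" where
  "chromatic_number \<Gamma> = Inf {enat k | k. colourable \<Gamma> k}"

definition clique_number :: "('a, 'b) pre_digraph \<Rightarrow> enat" where
  "clique_number \<Gamma> = Sup {enat (card K) | K. finite K \<and> is_clique \<Gamma> K}"

definition perfect_graph :: "('a, 'b) pre_digraph \<Rightarrow> bool" where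
  "perfect_graph \<Gamma> \<longleftrightarrow>
     (\<forall>W \<subseteq> verts \<Gamma>. chromatic_number (\<Gamma> \<restriction> W) = clique_number (\<Gamma> \<restriction> W))"

section \<open>Graphs of a group\<close>

definition power_graph :: "('a, 'm) monoid_scheme \<Rightarrow> 'a pair_pre_digraph" where
  "power_graph G =
     \<lparr> pverts = carrier G,
       parcs = {(a, b). a \<in> carrier G \<and> b \<in> carrier G \<and> a \<noteq> b \<and>
                        (a \<in> generate G {b} \<or> b \<in> generate G {a})} \<rparr>"

definition enhanced_power_graph :: "('a, 'm) monoid_scheme \<Rightarrow> 'a pair_pre_digraph" where
  "enhanced_power_graph G =
     \<lparr> pverts = carrier G,
       parcs = {(a, b). a \<in> carrier G \<and> b \<in> carrier G \<and> a \<noteq> b \<and>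
                        cyclic_group (subgroup_generated G {a, b})} \<rparr>"

definition graph_minus :: "'a pair_pre_digraph \<Rightarrow> 'a pair_pre_digraph \<Rightarrow> 'a pair_pre_digraph" where
  "graph_minus \<Gamma> \<Delta> = \<lparr> pverts = pverts \<Gamma>, parcs = parcs \<Gamma> - parcs \<Delta> \<rparr>"

definition remove_isolated :: "'a pair_pre_digraph \<Rightarrow> 'a pair_pre_digraph" where
  "remove_isolated \<Gamma> =
     \<lparr> pverts = {x \<in> pverts \<Gamma>. \<exists>y. (x, y) \<in> parcs \<Gamma> \<or> (y, x) \<in> parcs \<Gamma>}, parcs = parcs \<Gamma> \<rparr>"

definition difference_graph :: "('a, 'm) monoid_scheme \<Rightarrow> 'a pair_pre_digraph" where
  "difference_graph G = remove_isolated (graph_minus (enhanced_power_graph G) (power_graph G))"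

definition minimal_imperfect_group :: "('a, 'm) monoid_scheme \<Rightarrow> bool" where
  "minimal_imperfect_group G \<longleftrightarrow>
     group G \<and>
     \<not> perfect_graph (with_proj (difference_graph G)) \<and>
     (\<forall>H. subgroup H G \<and> H \<noteq> carrier G \<longrightarrow>
        perfect_graph (with_proj (difference_graph (G\<lparr>carrier := H\<rparr>))))"

end

theory Submission
  imports Defs "HOL-Algebra.Multiplicative_Group" "HOL-Computational_Algebra.Squarefree"
    "HOL-Number_Theory.Cong"
begin

text \<open>
  In a finite cyclic group, membership in the cyclic subgroup of an element is divisibility of orders.
  Hence x and y are adjacent in the difference graph iff they lie in a common cyclic subgroup
  and their orders are incomparable under divisibility.

  In a proper subgroup H of the group of order ppqr and exponent pqr, the first condition follows
  from the second: elements of coprime orders generate a cyclic group, and for incomparable orders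
  that are not coprime the lcm is pqr, so H has an element of order pqr and is cyclic.
  The difference graph of H is therefore the incomparability graph of subsets of {p, q, r}
  (the prime divisors of the orders), up to repeated vertices: a blow-up of an induced
  subgraph of a prism, which is perfect.

  In the whole group, two elements of order pq and pr whose p-parts are independent are not adjacent,
  and this closes an induced five-cycle with orders q, r, pq, qr, pr.
\<close>

section \<open>Perfect graphs\<close>

lemma dominates_induce_subgraph_iff:
  "u \<rightarrow>\<^bsub>\<Gamma> \<restriction> W\<^esub> v \<longleftrightarrow> u \<in> W \<and> v \<in> W \<and> u \<rightarrow>\<^bsub>\<Gamma>\<^esub> v"
  by (auto simp: arcs_ends_def arc_to_ends_def)

lemma card_clique_le_colours:
  assumes "colourable \<Gamma> k" "is_clique \<Gamma> K"
  shows "card K \<le> k"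
proof -
  obtain c where c: "c ` verts \<Gamma> \<subseteq> {..<k}" "\<And>u v. u \<rightarrow>\<^bsub>\<Gamma>\<^esub> v \<Longrightarrow> c u \<noteq> c v"
    using assms(1) unfolding colourable_def by blast
  have "inj_on c K"
    using assms(2) c(2) unfolding is_clique_def inj_on_def by blast
  moreover have "c ` K \<subseteq> {..<k}"
    using assms(2) c(1) unfolding is_clique_def by blast
  ultimately show ?thesis
    using card_inj_on_le[of c K "{..<k}"] by simp
qed

text \<open>A clique with as many vertices as there are colours certifies optimality: no colouring
  can use fewer colours than a clique has vertices.\<close>

lemma chromatic_number_eq_clique_number:
  assumes "colourable \<Gamma> (card K)" "is_clique \<Gamma> K" "finite K"
  shows "chromatic_number \<Gamma> = clique_number \<Gamma>"
proof (rule antisym)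
  have "chromatic_number \<Gamma> \<le> enat (card K)"
    unfolding chromatic_number_def using assms(1) by (intro Inf_lower) blast
  also have "\<dots> \<le> clique_number \<Gamma>"
    unfolding clique_number_def using assms(2,3) by (intro Sup_upper) blast
  finally show "chromatic_number \<Gamma> \<le> clique_number \<Gamma>" .
  show "clique_number \<Gamma> \<le> chromatic_number \<Gamma>"
    unfolding clique_number_def chromatic_number_def
    by (intro Sup_least Inf_greatest) (auto intro: card_clique_le_colours)
qed

text \<open>A vertex is read as the subset of the three predicates that hold of it, and
  comparability is inclusion in one direction or the other. Distinct vertices with the same subset
  count as comparable, which yields the independent classes of a blow-up.\<close>

definition comparable3 :: "('a \<Rightarrow> bool) \<Rightarrow> ('a \<Rightarrow> bool) \<Rightarrow> ('a \<Rightarrow> bool) \<Rightarrow> 'a \<Rightarrow> 'a \<Rightarrow> bool" where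
  "comparable3 P Q R u v \<longleftrightarrow>
     (P u \<longrightarrow> P v) \<and> (Q u \<longrightarrow> Q v) \<and> (R u \<longrightarrow> R v) \<or>
     (P v \<longrightarrow> P u) \<and> (Q v \<longrightarrow> Q u) \<and> (R v \<longrightarrow> R u)"

text \<open>Without the set \<open>{P}\<close> and one two-element set, the remaining subsets split
  into two chains, separated by a single predicate. For instance, if \<open>{P}\<close> and
  \<open>{P, Q}\<close> are missing, \<open>Q\<close> separates
  \<open>{Q} < {Q, R} < {P, Q, R}\<close> from \<open>{} < {R} < {P, R}\<close>.\<close>

lemma comparable3_two_chains:
  assumes "\<forall>v\<in>V. \<not> (P v \<and> \<not> Q v \<and> \<not> R v)"
    and "(\<forall>v\<in>V. \<not> (P v \<and> Q v \<and> \<not> R v)) \<or> (\<forall>v\<in>V. \<not> (P v \<and> \<not> Q v \<and> R v)) \<or>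
         (\<forall>v\<in>V. \<not> (\<not> P v \<and> Q v \<and> R v))"
  shows "\<exists>c :: 'a \<Rightarrow> bool. \<forall>u\<in>V. \<forall>v\<in>V. \<not> comparable3 P Q R u v \<longrightarrow> c u \<noteq> c v"
  using assms(2)
proof (elim disjE)
  assume "\<forall>v\<in>V. \<not> (P v \<and> Q v \<and> \<not> R v)"
  then show ?thesis
    using assms(1) unfolding comparable3_def by (intro exI[of _ Q]) blast
next
  assume "\<forall>v\<in>V. \<not> (P v \<and> \<not> Q v \<and> R v)"
  then show ?thesis
    using assms(1) unfolding comparable3_def by (intro exI[of _ R]) blast
next
  assume "\<forall>v\<in>V. \<not> (\<not> P v \<and> Q v \<and> R v)"
  then show ?thesis
    using assms(1) unfolding comparable3_def by (intro exI[of _ Q]) blast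
qed

text \<open>If all three singletons or all three two-element sets occur, they form a triangle, and
  three chains cover everything. Otherwise a singleton and a two-element set are missing, so two
  chains suffice, and any edge is a clique of matching size. The empty and edgeless graphs are
  treated separately.\<close>

lemma chromatic_eq_clique_incomparability3:
  assumes adj: "\<And>u v. u \<rightarrow>\<^bsub>\<Gamma>\<^esub> v \<longleftrightarrow> u \<in> verts \<Gamma> \<and> v \<in> verts \<Gamma> \<and> \<not> comparable3 P Q R u v"
  shows "chromatic_number \<Gamma> = clique_number \<Gamma>"
proof -
  let ?V = "verts \<Gamma>"
  let ?low = "(\<exists>v\<in>?V. P v \<and> \<not> Q v \<and> \<not> R v) \<and> (\<exists>v\<in>?V. \<not> P v \<and> Q v \<and> \<not> R v) \<and>
    (\<exists>v\<in>?V. \<not> P v \<and> \<not> Q v \<and> R v)"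
  let ?high = "(\<exists>v\<in>?V. \<not> P v \<and> Q v \<and> R v) \<and> (\<exists>v\<in>?V. P v \<and> \<not> Q v \<and> R v) \<and>
    (\<exists>v\<in>?V. P v \<and> Q v \<and> \<not> R v)"
  have sym: "comparable3 P Q R u v \<longleftrightarrow> comparable3 P Q R v u" for u v
    unfolding comparable3_def by blast
  have refl: "comparable3 P Q R v v" for v
    unfolding comparable3_def by blast
  consider "?V = {}" | v where "v \<in> ?V" "\<forall>u v. \<not> u \<rightarrow>\<^bsub>\<Gamma>\<^esub> v"
    | "?low \<or> ?high" | u v where "u \<rightarrow>\<^bsub>\<Gamma>\<^esub> v" "\<not> ?low" "\<not> ?high"
    by blast
  then show ?thesis
  proof cases
    case 1
    then have "colourable \<Gamma> (card {})"
      unfolding colourable_def by (simp add: adj)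
    then show ?thesis
      by (rule chromatic_number_eq_clique_number) (auto simp: is_clique_def)
  next
    case 2
    then have "colourable \<Gamma> (card {v})"
      unfolding colourable_def by (intro exI[of _ "\<lambda>_. 0"]) auto
    then show ?thesis
      by (rule chromatic_number_eq_clique_number) (use 2 in \<open>auto simp: is_clique_def\<close>)
  next
    case 3
    then obtain x y z where xyz: "x \<in> ?V" "y \<in> ?V" "z \<in> ?V"
      "\<not> comparable3 P Q R x y" "\<not> comparable3 P Q R x z" "\<not> comparable3 P Q R y z"
      unfolding comparable3_def by metis
    then have "x \<noteq> y" "x \<noteq> z" "y \<noteq> z"
      using refl by auto
    then have card: "card {x, y, z} = 3"
      by simp
    \<comment> \<open>The colour classes are the chains \<open>P < PQ\<close>, \<open>Q < QR\<close> and \<open>R < PR\<close>.\<close>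
    let ?c = "\<lambda>v. if P v \<and> \<not> R v then 0 else if Q v \<and> \<not> P v then 1
      else if R v \<and> \<not> Q v then 2 else (0::nat)"
    \<comment> \<open>The final default \<open>0\<close> is reached only when \<open>P\<close>,
      \<open>Q\<close>, \<open>R\<close> all hold or all fail; such a vertex is comparable with
      every vertex and has no neighbours.\<close>
    have "?c u \<noteq> ?c v" if "u \<rightarrow>\<^bsub>\<Gamma>\<^esub> v" for u v
      using that unfolding adj comparable3_def by (auto split: if_splits)
    then have "colourable \<Gamma> (card {x, y, z})"
      unfolding colourable_def card by (intro exI[of _ ?c]) auto
    then show ?thesis
      by (rule chromatic_number_eq_clique_number)
        (use xyz sym in \<open>auto simp: is_clique_def adj\<close>)
  next
    case 4
    have "\<exists>c :: 'a \<Rightarrow> bool. \<forall>u\<in>?V. \<forall>v\<in>?V. \<not> comparable3 P Q R u v \<longrightarrow> c u \<noteq> c v"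
    proof -
      \<comment> \<open>Comparability is invariant under permuting the predicates, so the missing
        singleton may be moved into the first position.\<close>
      consider "\<forall>v\<in>?V. \<not> (P v \<and> \<not> Q v \<and> \<not> R v)" | "\<forall>v\<in>?V. \<not> (Q v \<and> \<not> P v \<and> \<not> R v)"
        | "\<forall>v\<in>?V. \<not> (R v \<and> \<not> P v \<and> \<not> Q v)"
        using 4(2) by blast
      then show ?thesis
      proof cases
        case 1
        show ?thesis
          using comparable3_two_chains[OF 1] 4(3) by blast
      next
        case 2
        have eq: "comparable3 Q P R = comparable3 P Q R"
          unfolding comparable3_def by (intro ext) blast
        then show ?thesis
          using comparable3_two_chains[OF 2, unfolded eq] 4(3) by blast
      next
        case 3
        have eq: "comparable3 R P Q = comparable3 P Q R"
          unfolding comparable3_def by (intro ext) blast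
        then show ?thesis
          using comparable3_two_chains[OF 3, unfolded eq] 4(3) by blast
      qed
    qed
    then obtain c :: "'a \<Rightarrow> bool"
      where c: "\<And>u v. u \<in> ?V \<Longrightarrow> v \<in> ?V \<Longrightarrow> \<not> comparable3 P Q R u v \<Longrightarrow> c u \<noteq> c v"
      by blast
    have "u \<noteq> v"
      using 4(1) refl unfolding adj by auto
    then have card: "card {u, v} = 2"
      by simp
    have "(of_bool (c a) :: nat) \<noteq> of_bool (c b)" if "a \<rightarrow>\<^bsub>\<Gamma>\<^esub> b" for a b
      using that c unfolding adj by auto
    then have "colourable \<Gamma> (card {u, v})"
      unfolding colourable_def card by (intro exI[of _ "\<lambda>a. of_bool (c a)"]) auto
    then show ?thesis
      by (rule chromatic_number_eq_clique_number)
        (use 4(1) sym in \<open>auto simp: is_clique_def adj\<close>)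
  qed
qed

text \<open>The hypothesis is inherited by induced subgraphs with the same three predicates, so the
  equality of the two numbers holds for each of them.\<close>

lemma perfect_incomparability3:
  assumes "\<And>u v. u \<rightarrow>\<^bsub>\<Gamma>\<^esub> v \<longleftrightarrow> u \<in> verts \<Gamma> \<and> v \<in> verts \<Gamma> \<and> \<not> comparable3 P Q R u v"
  shows "perfect_graph \<Gamma>"
  unfolding perfect_graph_def
proof (intro allI impI)
  fix W assume W: "W \<subseteq> verts \<Gamma>"
  have "u \<rightarrow>\<^bsub>\<Gamma> \<restriction> W\<^esub> v \<longleftrightarrow>
      u \<in> verts (\<Gamma> \<restriction> W) \<and> v \<in> verts (\<Gamma> \<restriction> W) \<and> \<not> comparable3 P Q R u v" for u v
    using W by (auto simp: dominates_induce_subgraph_iff assms)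
  then show "chromatic_number (\<Gamma> \<restriction> W) = clique_number (\<Gamma> \<restriction> W)"
    by (rule chromatic_eq_clique_incomparability3)
qed

text \<open>The cycle contains no triangle, so its clique number is at most 2, while two colours
  would have to alternate around a cycle of odd length.\<close>

lemma induced_five_cycle_not_perfect:
  assumes V: "{a, b, c, d, e} \<subseteq> verts \<Gamma>"
    and edges: "a \<rightarrow>\<^bsub>\<Gamma>\<^esub> b" "b \<rightarrow>\<^bsub>\<Gamma>\<^esub> c" "c \<rightarrow>\<^bsub>\<Gamma>\<^esub> d" "d \<rightarrow>\<^bsub>\<Gamma>\<^esub> e" "e \<rightarrow>\<^bsub>\<Gamma>\<^esub> a"
    and nonedges: "\<not> a \<rightarrow>\<^bsub>\<Gamma>\<^esub> c" "\<not> b \<rightarrow>\<^bsub>\<Gamma>\<^esub> d" "\<not> c \<rightarrow>\<^bsub>\<Gamma>\<^esub> e" "\<not> d \<rightarrow>\<^bsub>\<Gamma>\<^esub> a" "\<not> e \<rightarrow>\<^bsub>\<Gamma>\<^esub> b"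
  shows "\<not> perfect_graph \<Gamma>"
proof
  assume "perfect_graph \<Gamma>"
  let ?W = "{a, b, c, d, e}"
  let ?\<Delta> = "\<Gamma> \<restriction> ?W"
  have eq: "chromatic_number ?\<Delta> = clique_number ?\<Delta>"
    using \<open>perfect_graph \<Gamma>\<close> V unfolding perfect_graph_def by blast
  have "card K \<le> 2" if K: "is_clique ?\<Delta> K" for K
  proof (rule ccontr)
    assume "\<not> card K \<le> 2"
    then obtain T where "T \<subseteq> K" "card T = 3"
      using obtain_subset_with_card_n[of 3 K] by auto
    then obtain x y z where xyz: "x \<in> K" "y \<in> K" "z \<in> K" "x \<noteq> y" "x \<noteq> z" "y \<noteq> z"
      by (auto simp: card_3_iff)
    have adj: "u \<rightarrow>\<^bsub>\<Gamma>\<^esub> v" if "u \<in> K" "v \<in> K" "u \<noteq> v" for u v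
      using K that unfolding is_clique_def dominates_induce_subgraph_iff by blast
    have "x \<in> ?W" "y \<in> ?W" "z \<in> ?W"
      using K xyz by (auto simp: is_clique_def)
    \<comment> \<open>Among any three vertices of the cycle, two are not consecutive. Both
      orientations of each pair are supplied because \<open>nonedges\<close> lists only one.\<close>
    then show False
      using nonedges adj[of x y] adj[of y x] adj[of x z] adj[of z x] adj[of y z] adj[of z y] xyz
      by (elim insertE emptyE; simp)
  qed
  then have "clique_number ?\<Delta> \<le> enat 2"
    unfolding clique_number_def by (intro Sup_least) auto
  moreover have "3 \<le> k" if "colourable ?\<Delta> k" for k
  proof (rule ccontr)
    assume "\<not> 3 \<le> k"
    obtain f where f: "f ` ?W \<subseteq> {..<k}" "\<And>u v. u \<rightarrow>\<^bsub>?\<Delta>\<^esub> v \<Longrightarrow> f u \<noteq> f v"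
      using \<open>colourable ?\<Delta> k\<close> unfolding colourable_def by auto
    have "f a < 2" "f b < 2" "f c < 2" "f d < 2" "f e < 2"
      using f(1) \<open>\<not> 3 \<le> k\<close> by auto
    moreover have "f a \<noteq> f b" "f b \<noteq> f c" "f c \<noteq> f d" "f d \<noteq> f e" "f e \<noteq> f a"
      by (rule f(2), simp add: dominates_induce_subgraph_iff edges)+
    ultimately show False
      by linarith
  qed
  then have "enat 3 \<le> chromatic_number ?\<Delta>"
    unfolding chromatic_number_def by (intro Inf_greatest) auto
  ultimately have "enat 3 \<le> enat 2"
    using eq by (metis order_trans)
  then show False
    by simp
qed

section \<open>The difference graph of a finite group\<close>

context group
begin

lemma generate_singleton_iff:
  assumes "x \<in> carrier G"
  shows "y \<in> generate G {x} \<longleftrightarrow> (\<exists>k::int. y = x [^] k)"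
  using generate_pow[OF assms] by auto

lemma nat_pow_in_generate:
  assumes "x \<in> carrier G"
  shows "x [^] (k::nat) \<in> generate G {x}"
  unfolding generate_singleton_iff[OF assms] by (metis int_pow_int)

text \<open>Subgroups of cyclic groups are cyclic: if \<open>x = w [^] i\<close> and
  \<open>y = w [^] j\<close>, then Bezout's identity shows that \<open>w [^] gcd i j\<close>
  generates the same subgroup as \<open>x\<close> and \<open>y\<close>.\<close>

lemma cyclic_subgroup_generated_pair_iff:
  assumes x: "x \<in> carrier G" and y: "y \<in> carrier G"
  shows "cyclic_group (subgroup_generated G {x, y}) \<longleftrightarrow>
    (\<exists>w\<in>carrier G. x \<in> generate G {w} \<and> y \<in> generate G {w})"
proof
  let ?K = "subgroup_generated G {x, y}"
  have K: "subgroup (carrier ?K) G"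
    by (rule subgroup_subgroup_generated)
  have xy: "x \<in> carrier ?K" "y \<in> carrier ?K"
    using subgroup_generated_subset_carrier_subset[of "{x, y}"] x y by auto
  {
    assume "cyclic_group ?K"
    then obtain w where w: "w \<in> carrier ?K" "carrier ?K = range (\<lambda>n::int. w [^]\<^bsub>?K\<^esub> n)"
      using group.cyclic_group[OF group_subgroup_generated] by blast
    have wG: "w \<in> carrier G"
      using w(1) K by (auto dest: subgroup.mem_carrier)
    have "carrier ?K = range (\<lambda>n::int. w [^] n)"
      using w int_pow_subgroup_generated[OF w(1)] by simp
    then show "\<exists>w\<in>carrier G. x \<in> generate G {w} \<and> y \<in> generate G {w}"
      using xy wG generate_singleton_iff[OF wG] by blast
  }
  {
    assume "\<exists>w\<in>carrier G. x \<in> generate G {w} \<and> y \<in> generate G {w}"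
    then obtain w and i j :: int where w: "w \<in> carrier G" "x = w [^] i" "y = w [^] j"
      by (auto simp: generate_singleton_iff)
    define g where "g = gcd i j"
    obtain s t where st: "s * i + t * j = g"
      using bezout_int[of i j] unfolding g_def by blast
    let ?z = "w [^] g"
    have "?z = x [^] s \<otimes> y [^] t"
      using w st by (simp add: int_pow_pow int_pow_mult[symmetric] mult.commute)
    moreover have "x [^] s \<in> carrier ?K" "y [^] t \<in> carrier ?K"
      using xy K by (auto intro: subgroup_int_pow_closed)
    ultimately have z: "?z \<in> carrier ?K"
      using K by (simp add: subgroup.m_closed)
    have zG: "?z \<in> carrier G"
      using w by simp
    have pow: "w [^] k \<in> range (\<lambda>n::int. ?z [^] n)" if "g dvd k" for k
      using that w by (auto simp: int_pow_pow elim!: dvdE)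
    have "{x, y} \<subseteq> range (\<lambda>n::int. ?z [^] n)"
      using pow[of i] pow[of j] w unfolding g_def by auto
    then have "carrier ?K \<subseteq> range (\<lambda>n::int. ?z [^] n)"
      by (intro subgroup_generated_minimal subgroup_of_powers zG)
    moreover have "range (\<lambda>n::int. ?z [^] n) \<subseteq> carrier ?K"
      using z K by (auto intro: subgroup_int_pow_closed)
    ultimately have "carrier ?K = range (\<lambda>n::int. ?z [^]\<^bsub>?K\<^esub> n)"
      using int_pow_subgroup_generated[OF z] by simp
    then show "cyclic_group ?K"
      using group.cyclic_group[OF group_subgroup_generated] z by blast
  }
qed

lemma ord_dvd_of_mem_generate:
  assumes "y \<in> carrier G" "x \<in> generate G {y}"
  shows "ord x dvd ord y"
proof -
  obtain k :: int where k: "x = y [^] k"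
    using assms by (auto simp: generate_singleton_iff)
  have "x [^] int (ord y) = (y [^] int (ord y)) [^] k"
    using assms(1) k by (simp add: int_pow_pow mult.commute)
  also have "\<dots> = \<one>"
    using assms(1) by (simp add: int_pow_int)
  finally show ?thesis
    using assms(1) k by (simp add: int_pow_eq_id)
qed

text \<open>A finite cyclic group has one subgroup for each divisor of its order. Concretely, with
  \<open>y = w [^] j\<close> and \<open>g = gcd j n\<close>, the element \<open>y\<close> generates
  the same subgroup as \<open>w [^] g\<close>, and the order condition forces the exponent of
  \<open>x\<close> to be a multiple of \<open>g\<close>.\<close>

lemma mem_generate_iff_ord_dvd:
  assumes w: "w \<in> carrier G" "ord w \<noteq> 0" and "x \<in> generate G {w}" "y \<in> generate G {w}"
  shows "x \<in> generate G {y} \<longleftrightarrow> ord x dvd ord y"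
proof
  have yG: "y \<in> carrier G"
    using assms generate_in_carrier by blast
  show "x \<in> generate G {y} \<Longrightarrow> ord x dvd ord y"
    by (rule ord_dvd_of_mem_generate[OF yG])
  assume dvd: "ord x dvd ord y"
  obtain i j :: int where ij: "x = w [^] i" "y = w [^] j"
    using assms by (auto simp: generate_singleton_iff)
  define n where "n = int (ord w)"
  define g where "g = gcd j n"
  have g: "g \<noteq> 0" "g dvd n" "g dvd j"
    using w unfolding g_def n_def by auto
  have "y [^] (n div g) = (w [^] n) [^] (j div g)"
    using w ij g by (simp add: int_pow_pow div_mult_swap dvd_div_mult mult.commute)
  also have "\<dots> = \<one>"
    using w by (simp add: n_def int_pow_int)
  finally have "int (ord y) dvd n div g"
    using yG by (simp add: int_pow_eq_id)
  then have "int (ord x) dvd n div g"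
    using dvd by (meson dvd_trans int_dvd_int_iff)
  then have "x [^] (n div g) = \<one>"
    using w ij by (simp add: int_pow_eq_id)
  then have "n dvd i * (n div g)"
    using w ij by (simp add: int_pow_pow int_pow_eq_id n_def)
  \<comment> \<open>Since \<open>n = g * (n div g)\<close>, the nonzero factor
    \<open>n div g\<close> can be cancelled.\<close>
  then have "g * (n div g) dvd i * (n div g)"
    using g by simp
  moreover have "n div g \<noteq> 0"
    using g w by (auto simp: n_def elim!: dvdE)
  ultimately have "g dvd i"
    by simp
  then obtain m where m: "i = g * m" ..
  \<comment> \<open>As \<open>w [^] n\<close> is trivial, Bezout's identity writes
    \<open>w [^] g\<close> as a power of \<open>y\<close>; its power \<open>x\<close> is then one
    too.\<close>
  obtain s t where st: "s * j + t * n = g"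
    using bezout_int[of j n] unfolding g_def by blast
  have "w [^] g = (w [^] j) [^] s \<otimes> (w [^] n) [^] t"
    using w st by (simp add: int_pow_pow int_pow_mult[symmetric] mult.commute)
  also have "\<dots> = y [^] s"
    using w ij yG by (simp add: n_def int_pow_int)
  finally have "w [^] g = y [^] s" .
  then have "x = y [^] (s * m)"
    using w ij m yG by (metis int_pow_pow)
  then show "x \<in> generate G {y}"
    using yG by (auto simp: generate_singleton_iff)
qed

text \<open>Inside a common cyclic subgroup, membership becomes divisibility of orders. The
  condition that \<open>x\<close> and \<open>y\<close> differ is absorbed, since equal elements have
  comparable orders.\<close>

lemma difference_graph_arc_iff:
  assumes "finite (carrier G)"
  shows "(x, y) \<in> parcs (difference_graph G) \<longleftrightarrow>
    x \<in> carrier G \<and> y \<in> carrier G \<and> \<not> ord x dvd ord y \<and> \<not> ord y dvd ord x \<and>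
    (\<exists>w\<in>carrier G. x \<in> generate G {w} \<and> y \<in> generate G {w})"
proof -
  have "ord w \<noteq> 0" if "w \<in> carrier G" for w
    using ord_ge_1[OF assms that] by simp
  then have iff: "x \<in> generate G {y} \<longleftrightarrow> ord x dvd ord y"
    if "w \<in> carrier G" "x \<in> generate G {w}" "y \<in> generate G {w}" for x y w
    using mem_generate_iff_ord_dvd that by blast
  have "(x, y) \<in> parcs (difference_graph G) \<longleftrightarrow> x \<in> carrier G \<and> y \<in> carrier G \<and> x \<noteq> y \<and>
      x \<notin> generate G {y} \<and> y \<notin> generate G {x} \<and> cyclic_group (subgroup_generated G {x, y})"
    unfolding difference_graph_def remove_isolated_def graph_minus_def enhanced_power_graph_def
      power_graph_def by auto
  also have "\<dots> \<longleftrightarrow> x \<in> carrier G \<and> y \<in> carrier G \<and> x \<noteq> y \<and>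
      x \<notin> generate G {y} \<and> y \<notin> generate G {x} \<and>
      (\<exists>w\<in>carrier G. x \<in> generate G {w} \<and> y \<in> generate G {w})"
    using cyclic_subgroup_generated_pair_iff by blast
  also have "\<dots> \<longleftrightarrow> x \<in> carrier G \<and> y \<in> carrier G \<and> \<not> ord x dvd ord y \<and> \<not> ord y dvd ord x \<and>
      (\<exists>w\<in>carrier G. x \<in> generate G {w} \<and> y \<in> generate G {w})"
    using iff by (metis dvd_refl)
  finally show ?thesis .
qed

end

lemma difference_graph_arc_verts:
  assumes "(x, y) \<in> parcs (difference_graph G)"
  shows "x \<in> pverts (difference_graph G)" "y \<in> pverts (difference_graph G)"
  using assms unfolding difference_graph_def remove_isolated_def graph_minus_def
    enhanced_power_graph_def by auto

lemma difference_graph_verts_subset: "pverts (difference_graph G) \<subseteq> carrier G"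
  unfolding difference_graph_def remove_isolated_def graph_minus_def enhanced_power_graph_def
  by auto

section \<open>Abelian groups of squarefree exponent\<close>

text \<open>A prime dividing the cofactor of \<open>gcd d e\<close> in \<open>d\<close> would also
  divide the gcd, so its square would divide \<open>n\<close>. Orders can therefore be replaced by
  their sets of prime divisors.\<close>

lemma squarefree_dvd_iff_primes:
  fixes d e n :: nat
  assumes "squarefree n" "d dvd n"
  shows "d dvd e \<longleftrightarrow> (\<forall>s. prime s \<longrightarrow> s dvd d \<longrightarrow> s dvd e)"
proof
  show "d dvd e \<Longrightarrow> \<forall>s. prime s \<longrightarrow> s dvd d \<longrightarrow> s dvd e"
    by (blast intro: dvd_trans)
  assume primes: "\<forall>s. prime s \<longrightarrow> s dvd d \<longrightarrow> s dvd e"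
  obtain k where k: "d = gcd d e * k"
    by (meson dvdE gcd_dvd1)
  have "k = 1"
  proof (rule ccontr)
    assume "k \<noteq> 1"
    then obtain s where s: "prime s" "s dvd k"
      using prime_factor_nat by blast
    then have "s dvd d"
      using k by (metis dvd_mult)
    then have "s dvd gcd d e"
      using primes s by simp
    then have "s ^ 2 dvd gcd d e * k"
      unfolding power2_eq_square using s(2) by (rule mult_dvd_mono)
    then have "s ^ 2 dvd n"
      using k assms(2) by (metis dvd_trans)
    then show False
      using assms(1) s(1) not_prime_unit squarefreeD by blast
  qed
  then show "d dvd e"
    using k by (metis gcd_dvd2 mult.right_neutral)
qed

lemma squarefree_prod_three_primes:
  fixes p q r :: nat
  assumes "prime p" "prime q" "prime r" "p \<noteq> q" "p \<noteq> r" "q \<noteq> r"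
  shows "squarefree (p * q * r)"
  using assms by (intro squarefree_mult_coprime squarefree_prime) (auto simp: primes_coprime)

lemma prime_dvd_three_primes:
  fixes p q r s :: nat
  assumes "prime p" "prime q" "prime r" "prime s" "s dvd p * q * r"
  shows "s \<in> {p, q, r}"
  using assms by (auto simp: prime_dvd_mult_iff primes_dvd_imp_eq)

text \<open>A common prime of \<open>a\<close> and \<open>b\<close>, a prime of \<open>a\<close>
  only and a prime of \<open>b\<close> only are distinct, so they exhaust \<open>p\<close>,
  \<open>q\<close>, \<open>r\<close>.\<close>

lemma lcm_incomparable_not_coprime:
  fixes a b p q r :: nat
  assumes p: "prime p" "prime q" "prime r" "p \<noteq> q" "p \<noteq> r" "q \<noteq> r"
    and ab: "a dvd p * q * r" "b dvd p * q * r" "\<not> a dvd b" "\<not> b dvd a" "\<not> coprime a b"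
  shows "lcm a b = p * q * r"
proof (rule dvd_antisym)
  show "lcm a b dvd p * q * r"
    using ab by simp
  note sf = squarefree_prod_three_primes[OF p]
  obtain s where s: "prime s" "s dvd a" "s dvd b"
    using ab(5) prime_factor_nat[of "gcd a b"] by (auto simp: coprime_iff_gcd_eq_1)
  obtain t where t: "prime t" "t dvd a" "\<not> t dvd b"
    using squarefree_dvd_iff_primes[OF sf ab(1)] ab(3) by blast
  obtain u where u: "prime u" "u dvd b" "\<not> u dvd a"
    using squarefree_dvd_iff_primes[OF sf ab(2)] ab(4) by blast
  have "{s, t, u} \<subseteq> {p, q, r}"
    using prime_dvd_three_primes[OF p(1-3)] s t u ab(1,2) by (meson dvd_trans empty_subsetI insert_subset)
  moreover have "s \<noteq> t" "s \<noteq> u" "t \<noteq> u"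
    using s t u by auto
  ultimately have "{p, q, r} = {s, t, u}"
    by auto
  then have "p dvd lcm a b" "q dvd lcm a b" "r dvd lcm a b"
    using s t u by (metis dvd_lcmI1 dvd_lcmI2 insertE insertI1 insert_commute empty_iff)+
  then show "p * q * r dvd lcm a b"
    using p by (intro divides_mult) (auto simp: primes_coprime)
qed

lemma (in group) dvd_ord_of_mem_generate_coprime:
  assumes "x \<in> carrier G" "y \<in> carrier G" "w \<in> carrier G" "coprime (ord x) (ord y)"
    "x \<in> generate G {w}" "y \<in> generate G {w}"
  shows "ord x * ord y dvd ord w"
  using assms by (intro divides_mult ord_dvd_of_mem_generate)

section \<open>Combining elements of given orders in an abelian group\<close>

context comm_group
begin

text \<open>Raise \<open>x \<otimes> y\<close> to an exponent that is 0 modulo \<open>ord y\<close>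
  and 1 modulo \<open>ord x\<close>.\<close>

lemma mem_generate_mult_coprime:
  assumes x: "x \<in> carrier G" and y: "y \<in> carrier G" and "coprime (ord x) (ord y)"
  shows "x \<in> generate G {x \<otimes> y}"
proof -
  have "coprime (ord y) (ord x)"
    using assms(3) by (simp add: coprime_commute)
  then obtain u where "[ord y * u = 1] (mod ord x)"
    using cong_solve_coprime_nat by auto
  then have "[int (ord y * u) = 1] (mod int (ord x))"
    by (metis cong_int_iff of_nat_1)
  then have "int (ord x) dvd 1 - int (ord y * u)"
    by (metis cong_iff_dvd_diff cong_sym)
  then have "x [^] int (ord y * u) = x [^] (1 :: int)"
    using x by (simp only: int_pow_eq)
  then have "x [^] (ord y * u) = x"
    using x by (metis int_pow_1 int_pow_int)
  moreover have "y [^] (ord y * u) = \<one>"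
    using y by (simp add: pow_eq_id)
  ultimately have "(x \<otimes> y) [^] (ord y * u) = x"
    using x y by (simp add: nat_pow_distrib)
  then show ?thesis
    using nat_pow_in_generate[of "x \<otimes> y"] x y by (metis m_closed)
qed

lemma mem_generate_mult_coprime':
  assumes "x \<in> carrier G" "y \<in> carrier G" "coprime (ord x) (ord y)"
  shows "y \<in> generate G {x \<otimes> y}"
  using mem_generate_mult_coprime[of y x] assms by (simp add: m_comm coprime_commute)

text \<open>Raising \<open>x\<close> to the power \<open>g\<close>, the gcd of the two orders,
  strips the common factor. By squarefreeness the remaining order is coprime to
  \<open>ord y\<close>, so the product with \<open>y\<close> serves as witness.\<close>

lemma ex_lcm_dvd_ord:
  assumes x: "x \<in> carrier G" and y: "y \<in> carrier G" and sf: "squarefree (ord x)"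
  shows "\<exists>w\<in>carrier G. lcm (ord x) (ord y) dvd ord w"
proof -
  define g where "g = gcd (ord x) (ord y)"
  obtain k where k: "ord x = g * k"
    unfolding g_def by (meson dvdE gcd_dvd1)
  have "g \<noteq> 0"
    using k sf by (metis mult_zero_left not_squarefree_0)
  let ?x = "x [^] g"
  have ord: "ord ?x = k"
    using x k \<open>g \<noteq> 0\<close> by (simp add: ord_pow)
  have "coprime k (ord y)"
  proof (rule coprimeI)
    fix s assume s: "s dvd k" "s dvd ord y"
    then have "s dvd g"
      unfolding g_def using k by (metis dvd_mult gcd_greatest)
    then have "s ^ 2 dvd ord x"
      unfolding k power2_eq_square using s(1) by (rule mult_dvd_mono)
    then show "is_unit s"
      using sf squarefreeD by blast
  qed
  then have "k * ord y dvd ord (?x \<otimes> y)"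
    using dvd_ord_of_mem_generate_coprime[of ?x y "?x \<otimes> y"] mem_generate_mult_coprime[of ?x y]
      mem_generate_mult_coprime'[of ?x y] x y by (simp add: ord)
  moreover have "lcm (ord x) (ord y) = k * ord y"
  proof -
    have "g * lcm (ord x) (ord y) = g * (k * ord y)"
      using prod_gcd_lcm_nat[of "ord x" "ord y"] k unfolding g_def by (simp add: mult.assoc)
    then show ?thesis
      using \<open>g \<noteq> 0\<close> by simp
  qed
  ultimately show ?thesis
    using x y by (intro bexI[of _ "?x \<otimes> y"]) auto
qed

lemma ex_common_generator_of_incomparable_ord:
  assumes p: "prime p" "prime q" "prime r" "p \<noteq> q" "p \<noteq> r" "q \<noteq> r"
    and fin: "finite (carrier G)"
    and order: "order G dvd p * (p * q * r)" "order G \<noteq> p * (p * q * r)"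
    and exponent: "\<And>x. x \<in> carrier G \<Longrightarrow> ord x dvd p * q * r"
    and x: "x \<in> carrier G" and y: "y \<in> carrier G"
    and incomp: "\<not> ord x dvd ord y" "\<not> ord y dvd ord x"
  shows "\<exists>w\<in>carrier G. x \<in> generate G {w} \<and> y \<in> generate G {w}"
proof (cases "coprime (ord x) (ord y)")
  case True
  then show ?thesis
    using mem_generate_mult_coprime mem_generate_mult_coprime' x y by blast
next
  case False
  let ?n = "p * q * r"
  have "?n \<noteq> 0"
    using p by auto
  have "squarefree (ord x)"
    using squarefree_mono[OF exponent[OF x] squarefree_prod_three_primes[OF p]] .
  then obtain w where w: "w \<in> carrier G" "?n dvd ord w"
    using ex_lcm_dvd_ord[OF x y] lcm_incomparable_not_coprime[OF p exponent exponent incomp False] x y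
    by auto
  then have ord: "ord w = ?n"
    using exponent by (auto intro: dvd_antisym)
  \<comment> \<open>The index \<open>k\<close> of the subgroup generated by \<open>w\<close> divides
    \<open>p\<close> but is not \<open>p\<close>, so \<open>w\<close> generates the whole
    group.\<close>
  obtain k where k: "order G = ?n * k"
    using ord_dvd_group_order[OF w(1)] ord by auto
  then have "k dvd p"
    using order(1) \<open>?n \<noteq> 0\<close> by (simp add: mult.commute)
  moreover have "k \<noteq> p"
    using order(2) k by (auto simp: mult.commute)
  ultimately have "k = 1"
    using p(1) by (auto simp: prime_nat_iff)
  then have "card (generate G {w}) = card (carrier G)"
    using generate_pow_card[OF w(1)] k ord by (simp add: order_def)
  moreover have "generate G {w} \<subseteq> carrier G"
    using w by (simp add: generate_incl)
  ultimately have "generate G {w} = carrier G"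
    using fin by (metis card_subset_eq)
  then show ?thesis
    using w x y by blast
qed

text \<open>The three predicates are divisibility of the order by \<open>p\<close>, \<open>q\<close>
  and \<open>r\<close>; the common cyclic subgroup comes for free from incomparability.\<close>

lemma perfect_difference_graph:
  assumes p: "prime p" "prime q" "prime r" "p \<noteq> q" "p \<noteq> r" "q \<noteq> r"
    and fin: "finite (carrier G)"
    and order: "order G dvd p * (p * q * r)" "order G \<noteq> p * (p * q * r)"
    and exponent: "\<And>x. x \<in> carrier G \<Longrightarrow> ord x dvd p * q * r"
  shows "perfect_graph (with_proj (difference_graph G))"
proof (rule perfect_incomparability3)
  fix x y
  let ?P = "\<lambda>s x. s dvd ord x"
  have dvd: "ord x dvd ord y \<longleftrightarrow> (?P p x \<longrightarrow> ?P p y) \<and> (?P q x \<longrightarrow> ?P q y) \<and> (?P r x \<longrightarrow> ?P r y)"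
    if "x \<in> carrier G" for x y
  proof -
    have "s \<in> {p, q, r}" if "prime s" "s dvd ord x" for s
      using prime_dvd_three_primes[OF p(1-3) that(1)] that(2) exponent[OF \<open>x \<in> carrier G\<close>] dvd_trans
      by blast
    then show ?thesis
      using squarefree_dvd_iff_primes[OF squarefree_prod_three_primes[OF p] exponent[OF that]] p(1-3)
      by blast
  qed
  have "(x, y) \<in> parcs (difference_graph G) \<longleftrightarrow>
      x \<in> carrier G \<and> y \<in> carrier G \<and> \<not> ord x dvd ord y \<and> \<not> ord y dvd ord x"
    unfolding difference_graph_arc_iff[OF fin]
    using ex_common_generator_of_incomparable_ord[OF assms, of x y] by blast
  also have "\<dots> \<longleftrightarrow> x \<in> carrier G \<and> y \<in> carrier G \<and> \<not> comparable3 (?P p) (?P q) (?P r) x y"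
    by (cases "x \<in> carrier G \<and> y \<in> carrier G") (auto simp: comparable3_def dvd[of x y] dvd[of y x])
  \<comment> \<open>Removing isolated vertices preserves the equivalence: two incomparable elements
    of the carrier form an arc, so both survive as vertices.\<close>
  finally show "x \<rightarrow>\<^bsub>with_proj (difference_graph G)\<^esub> y \<longleftrightarrow>
      x \<in> verts (with_proj (difference_graph G)) \<and> y \<in> verts (with_proj (difference_graph G)) \<and>
      \<not> comparable3 (?P p) (?P q) (?P r) x y"
    using difference_graph_arc_verts[of x y G] difference_graph_verts_subset[of G]
    by (simp only: with_proj_simps) blast
qed

end

section \<open>Products of cyclic groups\<close>

lemma nat_pow_DirProd:
  "(x, y) [^]\<^bsub>G \<times>\<times> H\<^esub> (k::nat) = (x [^]\<^bsub>G\<^esub> k, y [^]\<^bsub>H\<^esub> k)"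
  by (induction k) auto

lemma comm_group_DirProd:
  assumes "comm_group G" "comm_group H"
  shows "comm_group (G \<times>\<times> H)"
proof (rule group.group_comm_groupI)
  show "group (G \<times>\<times> H)"
    using assms by (simp add: DirProd_group comm_group.axioms(2))
  fix x y assume "x \<in> carrier (G \<times>\<times> H)" "y \<in> carrier (G \<times>\<times> H)"
  then show "x \<otimes>\<^bsub>G \<times>\<times> H\<^esub> y = y \<otimes>\<^bsub>G \<times>\<times> H\<^esub> x"
    using assms by (auto simp: mult_DirProd' comm_groupE(4))
qed

section \<open>The group of order \<open>p * n\<close> with \<open>n = p * q * r\<close>\<close>

context
  fixes p q r :: nat
  assumes p: "prime p" "prime q" "prime r" "p \<noteq> q" "p \<noteq> r" "q \<noteq> r"
begin

private abbreviation (input) "n \<equiv> p * q * r"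
private abbreviation (input) "G \<equiv> integer_mod_group n \<times>\<times> integer_mod_group p"

interpretation G: comm_group G
  by (intro comm_group_DirProd abelian_integer_mod_group)

private lemma pos: "0 < p" "0 < q" "0 < r" "1 < p" "1 < q" "1 < r"
  using p prime_gt_0_nat prime_gt_1_nat by auto

private lemma carrier_iff: "(int a, int c) \<in> carrier G \<longleftrightarrow> a < n \<and> c < p"
  using pos by (simp add: carrier_integer_mod_group del: of_nat_mult)

private lemma finite_carrier: "finite (carrier G)"
  using pos by (simp add: carrier_integer_mod_group)

private lemma order_G: "order G = p * n"
  using pos by (simp add: order_def carrier_integer_mod_group card_cartesian_product del: of_nat_mult)

private lemma pow_G: "(int a, int c) [^]\<^bsub>G\<^esub> (k::nat) = (int (k * a mod n), int (k * c mod p))"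
  by (simp add: nat_pow_DirProd zmod_int)

private lemma ord_dvd_iff:
  assumes "a < n" "c < p"
  shows "G.ord (int a, int c) dvd k \<longleftrightarrow> n dvd k * a \<and> p dvd k * c"
proof -
  have "G.ord (int a, int c) dvd k \<longleftrightarrow> (int a, int c) [^]\<^bsub>G\<^esub> k = \<one>\<^bsub>G\<^esub>"
    using assms G.pow_eq_id carrier_iff by metis
  then show ?thesis
    unfolding pow_G by (simp add: dvd_eq_mod_eq_0)
qed

text \<open>A natural number is determined by its multiples, so computing an order reduces to
  solving two divisibility conditions.\<close>

private lemma ord_eqI:
  assumes "a < n" "c < p" "\<And>k. n dvd k * a \<and> p dvd k * c \<longleftrightarrow> d dvd k"
  shows "G.ord (int a, int c) = d"
  using ord_dvd_iff[OF assms(1,2)] assms(3) by (metis dvd_antisym dvd_refl)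

private lemma bounds: "p * r < n" "p * q < n" "r < n" "p < n" "1 < n"
proof -
  have "p * r * 1 < p * r * q" "p * q * 1 < p * q * r" "r * 1 < r * (p * q)" "p * 1 < p * (q * r)"
    using pos by (auto intro!: mult_strict_left_mono simp: one_less_mult)
  then show "p * r < n" "p * q < n" "r < n" "p < n"
    by (simp_all add: mult_ac)
  then show "1 < n"
    using pos by linarith
qed

text \<open>The first five elements are the vertices of the five-cycle. The last one supplies a
  \<open>p\<close>-part independent of the first factor.\<close>

private lemma ord_vertices:
  "G.ord (int (p * r), int 0) = q" "G.ord (int (p * q), int 0) = r"
  "G.ord (int r, int 0) = p * q" "G.ord (int p, int 0) = q * r"
  "G.ord (int (p * q), int 1) = p * r" "G.ord (int 0, int 1) = p"
proof -
  have c: "coprime p r"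
    using p primes_coprime by blast
  have 1: "n dvd k * (p * r) \<longleftrightarrow> q dvd k" for k
    using pos by (metis dvd_times_right_cancel_iff mult.commute mult.left_commute mult_is_0 neq0_conv)
  have 2: "n dvd k * (p * q) \<longleftrightarrow> r dvd k" for k
    using pos by (metis dvd_times_right_cancel_iff mult.commute mult_is_0 neq0_conv)
  have 3: "n dvd k * r \<longleftrightarrow> p * q dvd k" for k
    using pos by simp
  have 4: "n dvd k * p \<longleftrightarrow> q * r dvd k" for k
    using pos by (metis dvd_times_left_cancel_iff mult.commute mult.assoc neq0_conv)
  have 5: "r dvd k \<and> p dvd k \<longleftrightarrow> p * r dvd k" for k
    using c by (metis divides_mult mult.commute coprime_commute dvd_mult_left dvd_mult_right)
  show "G.ord (int (p * r), int 0) = q" "G.ord (int (p * q), int 0) = r"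
    "G.ord (int r, int 0) = p * q" "G.ord (int p, int 0) = q * r"
    "G.ord (int (p * q), int 1) = p * r" "G.ord (int 0, int 1) = p"
    by (rule ord_eqI; use pos bounds in \<open>simp only: 1 2 3 4 5 mult_0_right dvd_0_right simp_thms mult_1_right\<close>; fail)+
qed

text \<open>Four of the five non-edges hold because one order divides the other. Only
  \<open>v3\<close> and \<open>v5\<close>, of incomparable orders \<open>p * q\<close> and
  \<open>p * r\<close>, need an argument about their \<open>p\<close>-parts.\<close>

private lemma not_perfect: "\<not> perfect_graph (with_proj (difference_graph G))"
proof -
  let ?D = "difference_graph G"
  have arc: "(x, y) \<in> parcs ?D"
    if "w \<in> carrier G" "x \<in> generate G {w}" "y \<in> generate G {w}"
      "\<not> G.ord x dvd G.ord y" "\<not> G.ord y dvd G.ord x" for w x y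
    using that G.generate_in_carrier[of "{w}"] unfolding G.difference_graph_arc_iff[OF finite_carrier]
    by blast
  have no_arc: "(x, y) \<notin> parcs ?D" if "G.ord x dvd G.ord y \<or> G.ord y dvd G.ord x" for x y
    using that unfolding G.difference_graph_arc_iff[OF finite_carrier] by blast
  have primes: "\<not> p dvd q" "\<not> q dvd p" "\<not> p dvd r" "\<not> r dvd p" "\<not> q dvd r" "\<not> r dvd q"
    using p primes_dvd_imp_eq by blast+
  have indiv: "\<not> p dvd q * r" "\<not> q dvd p * r" "\<not> r dvd p * q"
    using p primes by (simp_all add: prime_dvd_mult_iff)
  have indiv': "\<not> p * q dvd r" "\<not> p * q dvd q * r" "\<not> q * r dvd p * q" "\<not> q * r dvd p * r"
    "\<not> p * r dvd q * r" "\<not> p * r dvd q"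
    using primes indiv dvd_mult_left dvd_mult_right by blast+

  define v1 where "v1 = (int (p * r), int 0)"
  define v2 where "v2 = (int (p * q), int 0)"
  define v3 where "v3 = (int r, int 0)"
  define v4 where "v4 = (int p, int 0)"
  define v5 where "v5 = (int (p * q), int 1)"
  define y where "y = (int 0, int 1)"
  note v_defs = v1_def v2_def v3_def v4_def v5_def y_def
  have ord: "G.ord v1 = q" "G.ord v2 = r" "G.ord v3 = p * q" "G.ord v4 = q * r"
    "G.ord v5 = p * r" "G.ord y = p"
    unfolding v_defs by (rule ord_vertices)+

  \<comment> \<open>This generator of the first factor accounts for the edges among
    \<open>v1\<close>, \<open>v2\<close>, \<open>v3\<close>, \<open>v4\<close>.\<close>
  let ?u = "(int 1, int 0)"
  have u: "?u \<in> carrier G"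
    unfolding carrier_iff using bounds pos by simp
  have u_pow: "(int a, int 0) \<in> generate G {?u}" if "a < n" for a
    using G.nat_pow_in_generate[OF u, of a] that unfolding pow_G by simp
  have gen_u: "v1 \<in> generate G {?u}" "v2 \<in> generate G {?u}" "v3 \<in> generate G {?u}"
    "v4 \<in> generate G {?u}"
    unfolding v_defs by (rule u_pow; rule bounds)+

  \<comment> \<open>The orders \<open>q * r\<close> and \<open>p\<close> are coprime, so
    \<open>?w\<close> generates both \<open>v4\<close> and \<open>y\<close>, hence also
    \<open>v1 = r v4\<close> and \<open>v5 = q v4 + y\<close> in additive notation. This gives the
    two edges at \<open>v5\<close>.\<close>
  let ?w = "v4 \<otimes>\<^bsub>G\<^esub> y"
  have v4: "v4 \<in> carrier G" and y: "y \<in> carrier G"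
    unfolding v_defs carrier_iff using bounds pos by simp_all
  then have w: "?w \<in> carrier G"
    by (rule G.m_closed)
  have sub: "subgroup (generate G {?w}) G"
    using w by (intro G.generate_is_subgroup) simp
  have "coprime (G.ord v4) (G.ord y)"
    unfolding ord using p(1) indiv(1) by (metis coprime_commute prime_imp_coprime)
  then have gen_w: "v4 \<in> generate G {?w}" "y \<in> generate G {?w}"
    using G.mem_generate_mult_coprime[OF v4 y] G.mem_generate_mult_coprime'[OF v4 y] by auto
  have pow_w: "v4 [^]\<^bsub>G\<^esub> k \<in> generate G {?w}" for k :: nat
    using G.subgroup_int_pow_closed[OF sub gen_w(1), of "int k"] by (simp only: int_pow_int)
  have "v1 = v4 [^]\<^bsub>G\<^esub> r"
    unfolding v_defs pow_G using bounds by (simp add: mult.commute)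
  then have v1: "v1 \<in> generate G {?w}"
    using pow_w by simp
  have "v5 = v4 [^]\<^bsub>G\<^esub> q \<otimes>\<^bsub>G\<^esub> y"
    unfolding v_defs pow_G using bounds pos by (simp add: mult.commute flip: of_nat_mult zmod_int)
  then have v5: "v5 \<in> generate G {?w}"
    using subgroup.m_closed[OF sub pow_w gen_w(2)] by simp

  have arcs: "(v1, v2) \<in> parcs ?D" "(v2, v3) \<in> parcs ?D" "(v3, v4) \<in> parcs ?D"
    by (rule arc[OF u]; use gen_u primes indiv indiv' in \<open>simp only: ord not_False_eq_True\<close>; fail)+
  have arcs': "(v4, v5) \<in> parcs ?D" "(v5, v1) \<in> parcs ?D"
    by (rule arc[OF w]; use gen_w v1 v5 primes indiv indiv' in \<open>simp only: ord not_False_eq_True\<close>; fail)+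

  have "(v3, v5) \<notin> parcs ?D"
  proof
    \<comment> \<open>If \<open>v3\<close> and \<open>v5\<close> are multiples \<open>i z\<close> and \<open>j z\<close>, the second components force
      \<open>p\<close> to divide \<open>i\<close>, which contradicts the first component of \<open>v3\<close>.\<close>
    assume "(v3, v5) \<in> parcs ?D"
    then obtain z where z: "z \<in> carrier G" "v3 \<in> generate G {z}" "v5 \<in> generate G {z}"
      unfolding G.difference_graph_arc_iff[OF finite_carrier] by blast
    then obtain s t where "z = (int s, int t)"
      using pos by (cases z) (auto simp: carrier_integer_mod_group elim!: nonneg_int_cases)
    then obtain i j where ij: "v3 = (int s, int t) [^]\<^bsub>G\<^esub> (i::nat)" "v5 = (int s, int t) [^]\<^bsub>G\<^esub> (j::nat)"
      using z G.generate_pow_on_finite_carrier[OF finite_carrier z(1)] by auto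
    then have mods: "i * s mod n = r" "i * t mod p = 0" "j * t mod p = 1"
      unfolding v_defs pow_G by simp_all
    have "p dvd i * t"
      using mods(2) by (rule mod_0_imp_dvd)
    moreover have "\<not> p dvd t"
      using mods(3) by (metis dvd_imp_mod_0 dvd_mult zero_neq_one)
    ultimately have "p dvd i * s"
      using p(1) by (simp add: prime_dvd_mult_iff)
    then have "p dvd i * s mod n"
      by (simp add: dvd_mod)
    then show False
      using mods(1) primes(3) by simp
  qed
  then have "\<not> v3 \<rightarrow>\<^bsub>with_proj ?D\<^esub> v5"
    by simp
  moreover have "{v1, v2, v3, v4, v5} \<subseteq> verts (with_proj ?D)"
    using difference_graph_arc_verts arcs arcs' by auto
  ultimately show ?thesis
    using arcs arcs' by (intro induced_five_cycle_not_perfect[of v1 v2 v3 v4 v5]) (simp_all add: no_arc ord)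
qed

text \<open>Lagrange's theorem and properness give the order conditions of
  \<open>perfect_difference_graph\<close>.\<close>

private lemma perfect_proper_subgroup:
  assumes H: "subgroup H G" "H \<noteq> carrier G"
  shows "perfect_graph (with_proj (difference_graph (G\<lparr>carrier := H\<rparr>)))"
proof -
  let ?H = "G\<lparr>carrier := H\<rparr>"
  interpret H: comm_group ?H
    by (rule group.group_comm_groupI[OF G.subgroup_imp_group[OF H(1)]])
      (use subgroup.mem_carrier[OF H(1)] G.m_comm in auto)
  have "H \<subset> carrier G"
    using H subgroup.subset by blast
  then have "card H < order G"
    unfolding order_def by (intro psubset_card_mono finite_carrier)
  then have "card H \<noteq> p * n"
    by (simp only: order_G)
  moreover have "card H dvd p * n"
    using G.lagrange[OF H(1)] by (metis dvd_triv_right order_G)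
  moreover have "H.ord x dvd n" if "x \<in> carrier ?H" for x
  proof -
    have "x \<in> carrier G"
      using that \<open>H \<subset> carrier G\<close> by auto
    then obtain a c where x: "x = (int a, int c)"
      using pos by (cases x) (auto simp: carrier_integer_mod_group elim!: nonneg_int_cases)
    \<comment> \<open>Multiplication by \<open>n\<close> kills both components, as \<open>p\<close>
      divides \<open>n\<close>.\<close>
    have "x [^]\<^bsub>G\<^esub> n = \<one>\<^bsub>G\<^esub>"
      unfolding x pow_G by simp
    then have "x [^]\<^bsub>?H\<^esub> n = \<one>\<^bsub>?H\<^esub>"
      by (simp flip: G.nat_pow_consistent)
    then show ?thesis
      using H.pow_eq_id[OF that] by blast
  qed
  ultimately show ?thesis
    using finite_subset[OF subgroup.subset[OF H(1)] finite_carrier]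
    by (intro H.perfect_difference_graph[OF p]) (auto simp: order_def)
qed

lemma minimal_imperfect_integer_mod_group: "minimal_imperfect_group G"
  unfolding minimal_imperfect_group_def
  using not_perfect perfect_proper_subgroup G.is_group by blast

end

theorem theorem7p7:
  fixes p q r :: nat
  assumes "prime p" "prime q" "prime r"
    and "p \<noteq> q" "p \<noteq> r" "q \<noteq> r"
  shows "minimal_imperfect_group (integer_mod_group (p * q * r) \<times>\<times> integer_mod_group p)"
  using assms by (rule minimal_imperfect_integer_mod_group)

end
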